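(* Let $n$ and $r$ be positive integers. Then $$\zeta_q(-n,w,u\mid w_1,\dots,w_r)=\frac{1}{(1-u)^r}\,H^{(r)}_n(u^{-1},w:q\mid w_1,\dots,w_r).$$
   Context: Let $q\in\mathbb{C}$ with $0<|q|<1$, fix a value of $\log q$, and put $q^x=\exp(x\log q)$, $[x]=\frac{1-q^x}{1-q}$. Let $u\in\mathbb{C}$ with $0<|u|<1$, and let $w,w_1,\dots,w_r\in\mathbb{C}$ have positive real parts, with $|q^{w_i}|<1$ for all $i$. The Euler-Barnes' type multiple Daehee $q$-Euler polynomials $H^{(r)}_n(u^{-1},w:q\mid w_1,\dots,w_r)$ ($n\ge0$) are defined by $$(1-u)^r\sum_{n_1,\dots,n_r=0}^{\infty}u^{n_1+\cdots+n_r}e^{[w+w_1n_1+\cdots+w_rn_r]t}=\sum_{n=0}^{\infty}H^{(r)}_n(u^{-1},w:q\mid w_1,\dots,w_r)\frac{t^n}{n!}.$$ The Euler-Barnes' type multiple Daehee $q$-zeta function is $$\zeta_q(s,w,u\mid w_1,\dots,w_r)=\sum_{n_1,\dots,n_r=0}^{\infty}\frac{u^{n_1+\cdots+n_r}}{[w+n_1w_1+\cdots+n_rw_r]^s}.$$ At $s=-n$ with $n\ge1$ an integer, the value is given by this (convergent) series with $[x]^{-s}$ the ordinary power $[x]^n$. *)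

theory Defs
  imports "HOL-Analysis.Analysis"
begin

text \<open>The parameter \<open>lq\<close> is the chosen value of \<open>log q\<close>, so \<open>exp lq = q\<close>
  wherever these notions are used.\<close>

definition q_pow :: "complex \<Rightarrow> complex \<Rightarrow> complex" where
  "q_pow lq x = exp (x * lq)"

definition q_num :: "complex \<Rightarrow> complex \<Rightarrow> complex \<Rightarrow> complex" where
  "q_num q lq x = (1 - q_pow lq x) / (1 - q)"

text \<open>The index tuples \<open>(n\<^sub>1, \<dots>, n\<^sub>r)\<close> are the extensional functions on \<open>{1..r}\<close>.\<close>

definition multi_index :: "nat \<Rightarrow> (nat \<Rightarrow> nat) set" where
  "multi_index r = ({1..r} \<rightarrow>\<^sub>E UNIV)"

definition barnes_form :: "nat \<Rightarrow> complex \<Rightarrow> (nat \<Rightarrow> complex) \<Rightarrow> (nat \<Rightarrow> nat) \<Rightarrow> complex" where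
  "barnes_form r w ws k = w + (\<Sum>i=1..r. ws i * of_nat (k i))"

definition daehee_euler_gf ::
  "nat \<Rightarrow> complex \<Rightarrow> complex \<Rightarrow> complex \<Rightarrow> complex \<Rightarrow> (nat \<Rightarrow> complex) \<Rightarrow> complex \<Rightarrow> complex" where
  "daehee_euler_gf r u w q lq ws t =
     (1 - u) ^ r *
     (\<Sum>\<^sub>\<infinity>k\<in>multi_index r. u ^ (\<Sum>i=1..r. k i) * exp (q_num q lq (barnes_form r w ws k) * t))"

text \<open>The first argument of \<open>H\<^sup>(\<^sup>r\<^sup>)\<close> is \<open>u\<inverse>\<close>, while its generating function is
  written in terms of \<open>u\<close>; hence the inverse of \<open>v\<close> below. Since \<open>[x]\<close> stays bounded on the
  arguments that occur, the generating function is entire in \<open>t\<close>, and the expansion is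
  required for every \<open>t\<close>.\<close>

definition daehee_euler ::
  "nat \<Rightarrow> nat \<Rightarrow> complex \<Rightarrow> complex \<Rightarrow> complex \<Rightarrow> complex \<Rightarrow> (nat \<Rightarrow> complex) \<Rightarrow> complex" where
  "daehee_euler r n v w q lq ws =
     (THE H. \<forall>t. (\<lambda>m. H m * t ^ m / fact m) sums daehee_euler_gf r (inverse v) w q lq ws t) n"

text \<open>\<open>[x]\<^sup>-\<^sup>s\<close> is taken with the principal branch of the logarithm. The branch is irrelevant
  at integers: at \<open>s = -n\<close> with \<open>n \<ge> 1\<close> it is the ordinary power \<open>[x]\<^sup>n\<close>, also when
  \<open>[x] = 0\<close> (lemma \<open>daehee_zeta_neg_nat\<close>).\<close>

definition daehee_zeta ::
  "nat \<Rightarrow> complex \<Rightarrow> complex \<Rightarrow> complex \<Rightarrow> complex \<Rightarrow> complex \<Rightarrow> (nat \<Rightarrow> complex) \<Rightarrow> complex" where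
  "daehee_zeta r s w u q lq ws =
     (\<Sum>\<^sub>\<infinity>k\<in>multi_index r. u ^ (\<Sum>i=1..r. k i) * q_num q lq (barnes_form r w ws k) powr (- s))"

lemma daehee_zeta_neg_nat:
  assumes "n \<ge> 1"
  shows "daehee_zeta r (- of_nat n) w u q lq ws =
    (\<Sum>\<^sub>\<infinity>k\<in>multi_index r. u ^ (\<Sum>i=1..r. k i) * q_num q lq (barnes_form r w ws k) ^ n)"
proof -
  have "z powr of_nat n = z ^ n" for z :: complex
    using assms by (cases "z = 0") (simp_all add: powr_nat')
  then show ?thesis
    by (simp add: daehee_zeta_def)
qed

end

theory Submission
  imports Defs
begin

text \<open>
  Write \<open>x\<^sub>k = [w + w\<^sub>1k\<^sub>1 + \<dots> + w\<^sub>rk\<^sub>r]\<close> and \<open>|k| = k\<^sub>1 + \<dots> + k\<^sub>r\<close>. All \<open>x\<^sub>k\<close> lie in one disc,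
  because each step \<open>w\<^sub>i\<close> multiplies \<open>q\<^sup>x\<close> by a number of modulus at most one
  (\<open>norm_q_num_barnes_form_le\<close>). The weights \<open>u ^ |k|\<close> are absolutely summable, their sum being
  a product of \<open>r\<close> geometric series. Hence the exponentials in the generating function may be
  expanded and the summation over powers of \<open>t\<close> moved outside, for every \<open>t\<close>
  (\<open>exp_moments_sums\<close>): the coefficient of \<open>t ^ m / m!\<close> is \<open>(1 - u) ^ r\<close> times the moment
  \<open>\<Sum>\<^sub>k u ^ |k| * x\<^sub>k ^ m\<close>. Power series coefficients are determined by the sum, so this is the
  polynomial value \<open>H\<^sub>m\<close> (\<open>daehee_euler_eq_moment\<close>), while the moment with \<open>m = n \<ge> 1\<close> is
  the zeta value at \<open>-n\<close> (\<open>daehee_zeta_neg_nat\<close>). Dividing by \<open>(1 - u) ^ r\<close>, nonzero since \<open>|u| < 1\<close>,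
  gives the identity.
\<close>

text \<open>Convergence everywhere makes both radii of convergence positive, so the identity theorem for power
  series applies near \<open>0\<close>.\<close>

lemma power_series_coeffs_unique:
  fixes a b :: "nat \<Rightarrow> complex"
  assumes a: "\<And>t. (\<lambda>m. a m * t ^ m) sums f t" and b: "\<And>t. (\<lambda>m. b m * t ^ m) sums f t"
  shows "a = b"
proof -
  have radius: "fps_conv_radius (Abs_fps c) > 0" if "\<And>t. (\<lambda>m. c m * t ^ m) sums f t" for c
  proof -
    have "ereal (norm (1 :: complex)) \<le> conv_radius c"
      using that[of 1] by (intro conv_radius_geI) (auto simp: sums_iff)
    then show ?thesis
      using less_le_trans[of 0 "ereal 1" "conv_radius c"] by (simp add: fps_conv_radius_def)
  qed
  have "eval_fps (Abs_fps a) t = eval_fps (Abs_fps b) t" for t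
    using sums_unique[OF a[of t]] sums_unique[OF b[of t]] by (simp add: eval_fps_def)
  then have "Abs_fps a = Abs_fps b"
    using radius[of a, OF a] radius[of b, OF b] by (intro eval_fps_eqD) auto
  then show ?thesis
    by (simp add: fps_eq_iff fun_eq_iff)
qed

text \<open>The family \<open>a k (x k t)\<^sup>m / m!\<close>, indexed by \<open>k\<close> and \<open>m\<close>, is absolutely summable: the moduli
  for fixed \<open>k\<close> sum to \<open>\<bar>a k\<bar> exp \<bar>x k t\<bar> \<le> \<bar>a k\<bar> exp (B \<bar>t\<bar>)\<close>. So the two summations commute.\<close>

lemma exp_moments_sums:
  fixes a x :: "'a \<Rightarrow> complex"
  assumes a: "(\<lambda>k. norm (a k)) summable_on A" and x: "\<And>k. k \<in> A \<Longrightarrow> norm (x k) \<le> B"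
  shows "(\<lambda>m. (\<Sum>\<^sub>\<infinity>k\<in>A. a k * x k ^ m) * t ^ m / fact m) sums (\<Sum>\<^sub>\<infinity>k\<in>A. a k * exp (x k * t))"
proof -
  define F where "F = (\<lambda>(k, m). a k * (x k * t) ^ m / fact m)"
  \<comment> \<open>Needed both for the complex rows and for the real series of their moduli.\<close>
  have exp_sums: "((\<lambda>m. c * y ^ m / fact m) has_sum c * exp y) UNIV"
    for c y :: "'b :: {real_normed_field, banach}"
  proof -
    have "((\<lambda>m. y ^ m /\<^sub>R fact m) has_sum exp y) UNIV"
      using exp_converges[of y] summable_norm_exp[of y] by (rule norm_summable_imp_has_sum[rotated])
    then have "((\<lambda>m. c * (y ^ m /\<^sub>R fact m)) has_sum c * exp y) UNIV"
      by (rule has_sum_cmult_right)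
    then show ?thesis
      by (simp add: scaleR_conv_of_real field_simps)
  qed
  have norm_row: "((\<lambda>m. norm (F (k, m))) has_sum norm (a k) * exp (norm (x k * t))) UNIV" for k
    using exp_sums[of "norm (a k)" "norm (x k * t)"]
    by (simp add: F_def norm_mult norm_divide norm_power)
  have row_sums: "(\<lambda>k. norm (norm (a k) * exp (norm (x k * t)))) summable_on A"
  proof (rule Infinite_Sum.abs_summable_on_comparison_test')
    show "(\<lambda>k. norm (a k) * exp (B * norm t)) summable_on A"
      using a by (rule summable_on_cmult_left)
    show "norm (norm (a k) * exp (norm (x k * t))) \<le> norm (a k) * exp (B * norm t)" if "k \<in> A" for k
      using x[OF that] by (simp add: norm_mult mult_left_mono mult_right_mono)
  qed
  have "(\<lambda>p. norm (F p)) summable_on A \<times> UNIV"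
  proof (rule Infinite_Sum.abs_summable_on_Sigma_iff[THEN iffD2], intro conjI ballI)
    show "(\<lambda>m. norm (F (k, m))) summable_on UNIV" for k
      using norm_row by (rule has_sum_imp_summable)
    show "(\<lambda>k. norm (\<Sum>\<^sub>\<infinity>m. norm (F (k, m)))) summable_on A"
      unfolding infsumI[OF norm_row] by (rule row_sums)
  qed
  then have "F summable_on A \<times> UNIV"
    by (rule abs_summable_summable)
  then obtain S where S: "(F has_sum S) (A \<times> UNIV)"
    by (auto simp: summable_on_def)
  have by_rows: "((\<lambda>k. a k * exp (x k * t)) has_sum S) A"
    by (rule has_sum_SigmaD[OF S]) (use exp_sums in \<open>simp add: F_def\<close>)
  have swapped: "((\<lambda>(m, k). F (k, m)) has_sum S) (UNIV \<times> A)"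
    using S by (subst (asm) has_sum_swap) simp
  have column: "((\<lambda>k. F (k, m)) has_sum (\<Sum>\<^sub>\<infinity>k\<in>A. a k * x k ^ m) * t ^ m / fact m) A" for m
  proof -
    have "(\<lambda>k. norm (a k * x k ^ m)) summable_on A"
    proof (rule Infinite_Sum.abs_summable_on_comparison_test')
      show "(\<lambda>k. norm (a k) * B ^ m) summable_on A"
        using a by (rule summable_on_cmult_left)
      show "norm (a k * x k ^ m) \<le> norm (a k) * B ^ m" if "k \<in> A" for k
        using x[OF that] by (simp add: norm_mult norm_power mult_left_mono power_mono)
    qed
    then have "((\<lambda>k. a k * x k ^ m) has_sum (\<Sum>\<^sub>\<infinity>k\<in>A. a k * x k ^ m)) A"
      by (rule has_sum_infsum[OF abs_summable_summable])
    then have "((\<lambda>k. a k * x k ^ m * (t ^ m / fact m)) has_sum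
                 (\<Sum>\<^sub>\<infinity>k\<in>A. a k * x k ^ m) * (t ^ m / fact m)) A"
      by (rule has_sum_cmult_left)
    then show ?thesis
      by (simp add: F_def power_mult_distrib mult.assoc)
  qed
  have "((\<lambda>m. (\<Sum>\<^sub>\<infinity>k\<in>A. a k * x k ^ m) * t ^ m / fact m) has_sum S) UNIV"
    by (rule has_sum_SigmaD[OF swapped]) (simp add: column)
  moreover have "S = (\<Sum>\<^sub>\<infinity>k\<in>A. a k * exp (x k * t))"
    using infsumI[OF by_rows] by simp
  ultimately show ?thesis
    by (simp add: has_sum_imp_sums)
qed

text \<open>The power of \<open>u\<close> factors over the coordinates of the index, so this is a product of
  absolutely convergent geometric series.\<close>

lemma geometric_multi_index_summable:
  fixes u :: complex
  assumes "norm u < 1"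
  shows "(\<lambda>k. norm (u ^ (\<Sum>i=1..r. k i))) summable_on multi_index r"
proof -
  have "summable (\<lambda>n. norm (u ^ n))"
    using assms by (simp add: norm_power summable_geometric)
  then have "(\<lambda>n. norm (u ^ n)) summable_on UNIV"
    by (intro norm_summable_imp_summable_on) simp
  then have "Infinite_Set_Sum.abs_summable_on (\<lambda>k. \<Prod>i\<in>{1..r}. u ^ k i) (multi_index r)"
    unfolding multi_index_def
    by (intro abs_summable_on_prod_PiE) (simp_all add: abs_summable_equivalent)
  then show ?thesis
    by (simp add: abs_summable_equivalent power_sum)
qed

text \<open>The map \<open>x \<mapsto> q\<^sup>x\<close> turns sums into products, so its modulus on the arguments in question is
  largest at \<open>k = 0\<close>. The bound is uniform in \<open>k\<close>, as \<open>exp_moments_sums\<close> requires.\<close>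

lemma norm_q_num_barnes_form_le:
  assumes "\<And>i. i \<in> {1..r} \<Longrightarrow> norm (q_pow lq (ws i)) \<le> 1"
  shows "norm (q_num q lq (barnes_form r w ws k)) \<le> (1 + norm (q_pow lq w)) / norm (1 - q)"
proof -
  have "q_pow lq (barnes_form r w ws k) = q_pow lq w * (\<Prod>i=1..r. q_pow lq (ws i) ^ k i)"
  proof -
    have "q_pow lq (ws i) ^ k i = exp (ws i * of_nat (k i) * lq)" for i
      by (simp add: q_pow_def mult_ac flip: exp_of_nat_mult)
    then show ?thesis
      by (simp add: q_pow_def barnes_form_def distrib_right exp_add sum_distrib_right exp_sum)
  qed
  moreover have "norm (\<Prod>i=1..r. q_pow lq (ws i) ^ k i) \<le> 1"
    using assms by (auto simp: norm_power prod_norm[symmetric] intro!: prod_le_1 power_le_one)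
  ultimately have "norm (q_pow lq (barnes_form r w ws k)) \<le> norm (q_pow lq w)"
    by (simp add: norm_mult mult_left_le)
  then have "norm (1 - q_pow lq (barnes_form r w ws k)) \<le> 1 + norm (q_pow lq w)"
    using norm_triangle_ineq4[of 1 "q_pow lq (barnes_form r w ws k)"] by simp
  then show ?thesis
    by (simp add: q_num_def norm_divide divide_right_mono)
qed

text \<open>The definite description in \<open>daehee_euler\<close> denotes the sequence of moments only once both
  existence and uniqueness of the expansion are known: \<open>exp_moments_sums\<close> gives the one,
  \<open>power_series_coeffs_unique\<close> the other.\<close>

lemma daehee_euler_eq_moment:
  assumes "norm u < 1" and "\<And>i. i \<in> {1..r} \<Longrightarrow> norm (q_pow lq (ws i)) \<le> 1"
  shows "daehee_euler r n (inverse u) w q lq ws =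
    (1 - u) ^ r *
    (\<Sum>\<^sub>\<infinity>k\<in>multi_index r. u ^ (\<Sum>i=1..r. k i) * q_num q lq (barnes_form r w ws k) ^ n)"
proof -
  define H where "H m = (1 - u) ^ r *
    (\<Sum>\<^sub>\<infinity>k\<in>multi_index r. u ^ (\<Sum>i=1..r. k i) * q_num q lq (barnes_form r w ws k) ^ m)" for m
  have H: "(\<lambda>m. H m * t ^ m / fact m) sums daehee_euler_gf r u w q lq ws t" for t
  proof -
    have "(\<lambda>m. (\<Sum>\<^sub>\<infinity>k\<in>multi_index r. u ^ (\<Sum>i=1..r. k i) * q_num q lq (barnes_form r w ws k) ^ m)
            * t ^ m / fact m) sums
          (\<Sum>\<^sub>\<infinity>k\<in>multi_index r. u ^ (\<Sum>i=1..r. k i) * exp (q_num q lq (barnes_form r w ws k) * t))"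
      using geometric_multi_index_summable[OF assms(1)] norm_q_num_barnes_form_le[OF assms(2)]
      by (rule exp_moments_sums)
    from sums_mult[OF this, of "(1 - u) ^ r"] show ?thesis
      by (simp add: H_def daehee_euler_gf_def mult.assoc)
  qed
  have "(THE H. \<forall>t. (\<lambda>m. H m * t ^ m / fact m) sums daehee_euler_gf r u w q lq ws t) = H"
  proof (rule the_equality)
    fix G assume "\<forall>t. (\<lambda>m. G m * t ^ m / fact m) sums daehee_euler_gf r u w q lq ws t"
    then have "(\<lambda>m. G m / fact m) = (\<lambda>m. H m / fact m)"
      using H by (intro power_series_coeffs_unique[where f = "daehee_euler_gf r u w q lq ws"]) simp_all
    then show "G = H"
      by (simp add: fun_eq_iff)
  qed (use H in blast)
  then show ?thesis
    by (simp add: daehee_euler_def H_def)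
qed

theorem theorem21:
  fixes q lq u w :: complex and ws :: "nat \<Rightarrow> complex" and n r :: nat
  assumes "0 < norm q" and "norm q < 1" and "exp lq = q"
    and "0 < norm u" and "norm u < 1"
    and "Re w > 0"
    and "\<And>i. i \<in> {1..r} \<Longrightarrow> Re (ws i) > 0"
    and "\<And>i. i \<in> {1..r} \<Longrightarrow> norm (q_pow lq (ws i)) < 1"
    and "n \<ge> 1" and "r \<ge> 1"
  shows "daehee_zeta r (- of_nat n) w u q lq ws =
    1 / (1 - u) ^ r * daehee_euler r n (inverse u) w q lq ws"
proof -
  have "u \<noteq> 1"
    using assms(5) by auto
  moreover have "norm (q_pow lq (ws i)) \<le> 1" if "i \<in> {1..r}" for i
    using assms(8)[OF that] by simp
  ultimately show ?thesis
    using daehee_zeta_neg_nat[OF assms(9)] daehee_euler_eq_moment[OF assms(5)] by simp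
qed

end
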